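(* Let $\lambda\in\mathbb{R}\setminus\{0\}$, $B_\lambda(z)=(1+\lambda z)^{1/\lambda}$ and $C_\lambda(z)=\exp\left(\frac1\lambda\big((1+z)^\lambda-1\big)\right)$. Then for all $n\ge k\ge0$, \[ \delta_{n,k}=\sum_{j=k}^{n}S_{B_\lambda}(n,j)s_{C_\lambda}(j,k),\qquad s(n,k)=\sum_{j=k}^{n}s_{C_\lambda}(n,j)\lambda^{j-k}s(j,k), \] and for all $x\in\mathbb{R}$, \[ (x)_n=\sum_{k=0}^{n}s_{C_\lambda}(n,k)(x)_{k,\lambda}. \]
   Context: Powers $(1+w)^{a}=\exp(a\log(1+w))$ with principal logarithm, for $w$ near $0$. For $F$ analytic at $0$ with $F(0)=1$, $\log F$ is the branch with $\log F(0)=0$ near $0$, and $F$-Stirling numbers are defined by $\frac{(\log F(z))^k}{k!}=\sum_{n\ge k}s_F(n,k)\frac{z^n}{n!}$ and $\frac{(F(z)-1)^k}{k!}=\sum_{n\ge k}S_F(n,k)\frac{z^n}{n!}$. $s(n,k)$ are the signed Stirling numbers of the first kind: $\frac{(\log(1+z))^k}{k!}=\sum_{n\ge k}s(n,k)\frac{z^n}{n!}$. $\delta_{n,k}$ is the Kronecker delta. $(x)_n=x(x-1)\cdots(x-n+1)$, $(x)_0=1$, and $(x)_{k,\lambda}=x(x-\lambda)\cdots(x-(k-1)\lambda)$ for $k\ge1$, $(x)_{0,\lambda}=1$. *)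

theory Defs
  imports "HOL-Complex_Analysis.Complex_Analysis"
begin

definition egf_coeff :: "(complex \<Rightarrow> complex) \<Rightarrow> nat \<Rightarrow> complex" where
  "egf_coeff f n = fact n * fps_nth (fps_expansion f 0) n"

text \<open>
  For \<open>F\<close> continuous at \<open>0\<close> with \<open>F 0 = 1\<close>, the branch of \<open>log F\<close> near \<open>0\<close> that vanishes
  at \<open>0\<close> is \<open>Ln (F z)\<close>. Only the germ at \<open>0\<close> enters the coefficients.
\<close>

definition stirling1_F :: "(complex \<Rightarrow> complex) \<Rightarrow> nat \<Rightarrow> nat \<Rightarrow> complex" where
  "stirling1_F F n k = egf_coeff (\<lambda>z. Ln (F z) ^ k / fact k) n"

definition stirling2_F :: "(complex \<Rightarrow> complex) \<Rightarrow> nat \<Rightarrow> nat \<Rightarrow> complex" where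
  "stirling2_F F n k = egf_coeff (\<lambda>z. (F z - 1) ^ k / fact k) n"

definition signed_stirling1 :: "nat \<Rightarrow> nat \<Rightarrow> complex" where
  "signed_stirling1 n k = egf_coeff (\<lambda>z. Ln (1 + z) ^ k / fact k) n"

definition B_fun :: "real \<Rightarrow> complex \<Rightarrow> complex" where
  "B_fun l z = (1 + of_real l * z) powr (1 / of_real l)"

definition C_fun :: "real \<Rightarrow> complex \<Rightarrow> complex" where
  "C_fun l z = exp (1 / of_real l * ((1 + z) powr of_real l - 1))"

definition ffact :: "real \<Rightarrow> nat \<Rightarrow> real" where
  "ffact x n = (\<Prod>i<n. x - of_nat i)"

definition ffact_step :: "real \<Rightarrow> nat \<Rightarrow> real \<Rightarrow> real" where
  "ffact_step x k l = (\<Prod>i<k. x - of_nat i * l)"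

text \<open>
  The coefficients are exactly those determined by the generating functions.
\<close>

lemma egf_coeff_sums:
  assumes "f analytic_on {0}"
  shows "\<forall>\<^sub>F z in nhds 0. (\<lambda>n. egf_coeff f n * z ^ n / fact n) sums f z"
proof -
  have *: "f has_fps_expansion fps_expansion f 0"
    using assms by (rule analytic_at_imp_has_fps_expansion_0)
  then have "\<forall>\<^sub>F z in nhds 0. z \<in> eball 0 (fps_conv_radius (fps_expansion f 0))"
    by (intro eventually_nhds_in_open) (auto simp: has_fps_expansion_def zero_ereal_def)
  moreover have "\<forall>\<^sub>F z in nhds 0. eval_fps (fps_expansion f 0) z = f z"
    using * by (auto simp: has_fps_expansion_def)
  ultimately show ?thesis
  proof eventually_elim
    case (elim z)
    then have "(\<lambda>n. fps_nth (fps_expansion f 0) n * z ^ n) sums f z"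
      using sums_eval_fps[of z "fps_expansion f 0"] by (simp add: in_eball_iff)
    then show ?case by (simp add: egf_coeff_def)
  qed
qed

lemma egf_coeff_unique:
  assumes "\<forall>\<^sub>F z in nhds 0. (\<lambda>n. a n * z ^ n / fact n) sums f z"
  shows "a n = egf_coeff f n"
proof -
  have "f has_fps_expansion Abs_fps (\<lambda>n. a n / fact n)"
    using assms by (intro has_fps_expansionI) (simp add: field_simps)
  then have "fps_nth (Abs_fps (\<lambda>n. a n / fact n)) n = (deriv ^^ n) f 0 / fact n"
    by (rule fps_nth_fps_expansion)
  then show ?thesis by (simp add: egf_coeff_def fps_expansion_def)
qed

lemma egf_coeff_power_eq_0:
  assumes "g analytic_on {0}" "g 0 = 0" "n < k"
  shows "egf_coeff (\<lambda>z. g z ^ k / fact k) n = 0"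
proof -
  define G where "G = fps_expansion g 0"
  have G: "g has_fps_expansion G"
    unfolding G_def using assms(1) by (rule analytic_at_imp_has_fps_expansion_0)
  have G0: "fps_nth G 0 = 0"
    using assms(2) by (simp add: G_def fps_expansion_def)
  have "(\<lambda>z. g z ^ k * (1 / fact k)) has_fps_expansion G ^ k * fps_const (1 / fact k)"
    by (intro fps_expansion_intros G)
  then have "(\<lambda>z. g z ^ k / fact k) has_fps_expansion G ^ k * fps_const (1 / fact k)"
    by simp
  then have "fps_nth (G ^ k * fps_const (1 / fact k)) n =
      (deriv ^^ n) (\<lambda>z. g z ^ k / fact k) 0 / fact n"
    by (rule fps_nth_fps_expansion)
  moreover have "fps_nth (G ^ k) n = 0"
    using G0 assms(3) startsby_zero_power_prefix by blast
  ultimately show ?thesis by (simp add: egf_coeff_def fps_expansion_def)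
qed

lemma analytic_Ln_F:
  assumes "F analytic_on {0}" "F 0 = 1"
  shows "(\<lambda>z. Ln (F z)) analytic_on {0}"
  using assms by (intro analytic_intros) auto

lemma stirling1_F_sums:
  assumes "F analytic_on {0}" "F 0 = 1"
  shows "\<forall>\<^sub>F z in nhds 0. (\<lambda>n. stirling1_F F n k * z ^ n / fact n) sums (Ln (F z) ^ k / fact k)"
    and "n < k \<Longrightarrow> stirling1_F F n k = 0"
  unfolding stirling1_F_def
  using assms
  by (auto intro!: egf_coeff_sums egf_coeff_power_eq_0 analytic_Ln_F analytic_intros)

lemma stirling2_F_sums:
  assumes "F analytic_on {0}" "F 0 = 1"
  shows "\<forall>\<^sub>F z in nhds 0. (\<lambda>n. stirling2_F F n k * z ^ n / fact n) sums ((F z - 1) ^ k / fact k)"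
    and "n < k \<Longrightarrow> stirling2_F F n k = 0"
  unfolding stirling2_F_def
  using assms
  by (auto intro!: egf_coeff_sums egf_coeff_power_eq_0 analytic_intros)

lemma B_fun_analytic: "B_fun l analytic_on {0}" and B_fun_0: "B_fun l 0 = 1"
proof -
  have "(\<lambda>z. (1 + of_real l * z) powr (1 / of_real l)) analytic_on {0}"
    by (cases "l = 0") (auto intro!: analytic_intros)
  then show "B_fun l analytic_on {0}" by (simp add: B_fun_def[abs_def])
qed (simp add: B_fun_def)

lemma C_fun_analytic: "C_fun l analytic_on {0}" and C_fun_0: "C_fun l 0 = 1"
proof -
  have "(\<lambda>z. exp (1 / of_real l * ((1 + z) powr of_real l - 1))) analytic_on {0}"
    by (cases "l = 0") (auto intro!: analytic_intros)
  then show "C_fun l analytic_on {0}" by (simp add: C_fun_def[abs_def])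
qed (simp add: C_fun_def)

end

theory Submission
  imports Defs
begin

text \<open>
  If \<open>g 0 = 0\<close>, composing power series gives
  \<open>[z\<^sup>n/n!] (f \<circ> g) = \<Sum>\<^sub>j [w\<^sup>j/j!] f \<cdot> [z\<^sup>n/n!] (g\<^sup>j/j!)\<close>. Near \<open>0\<close> one has
  \<open>Ln C(z) = ((1 + z)\<^sup>l - 1)/l\<close>, which is the compositional inverse of \<open>B - 1\<close>.
  The three identities are this expansion for the pairs \<open>(f, g)\<close> equal to
  \<open>((Ln C)\<^sup>k/k!, B - 1)\<close>, \<open>(Ln (1 + l w)\<^sup>k/(l\<^sup>k k!), Ln C)\<close> and \<open>((1 + l w) powr (x/l), Ln C)\<close>,
  for which \<open>f \<circ> g\<close> is \<open>z\<^sup>k/k!\<close>, \<open>Ln (1 + z)\<^sup>k/k!\<close> and \<open>(1 + z) powr x\<close>, respectively.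
\<close>

section \<open>Calculus of exponential coefficients\<close>

lemma egf_coeff_has_fps_expansion:
  assumes "f has_fps_expansion F"
  shows "egf_coeff f n = fact n * fps_nth F n"
  using fps_nth_fps_expansion[OF assms, of n] by (simp add: egf_coeff_def fps_expansion_def)

text \<open>An expansion depends only on the germ at 0. This lets identities between principal
  branches, valid only near 0, be used under \<open>egf_coeff\<close>.\<close>

lemma egf_coeff_cong:
  assumes "f analytic_on {0}" "\<forall>\<^sub>F z in nhds 0. f z = g z"
  shows "egf_coeff f n = egf_coeff g n"
proof -
  have "f has_fps_expansion fps_expansion f 0"
    using assms(1) by (rule analytic_at_imp_has_fps_expansion_0)
  moreover from this have "g has_fps_expansion fps_expansion f 0"
    using has_fps_expansion_cong[OF assms(2) refl] by blast
  ultimately show ?thesis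
    by (simp add: egf_coeff_has_fps_expansion)
qed

text \<open>Since \<open>g 0 = 0\<close>, the coefficient of \<open>F oo G\<close> at n is the
  finite sum of \<open>F\<close> at j times \<open>G ^ j\<close> at n. The factor j! in
  \<open>egf_coeff f j\<close> cancels the denominator of \<open>g z ^ j / fact j\<close>.\<close>

lemma egf_coeff_compose:
  assumes f: "f analytic_on {0}" and g: "g analytic_on {0}" "g 0 = 0"
  shows "egf_coeff (\<lambda>z. f (g z)) n =
    (\<Sum>j=0..n. egf_coeff f j * egf_coeff (\<lambda>z. g z ^ j / fact j) n)"
proof -
  define F where "F = fps_expansion f 0"
  define G where "G = fps_expansion g 0"
  have F: "f has_fps_expansion F"
    unfolding F_def using f by (rule analytic_at_imp_has_fps_expansion_0)
  have G: "g has_fps_expansion G"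
    unfolding G_def using g(1) by (rule analytic_at_imp_has_fps_expansion_0)
  have G0: "fps_nth G 0 = 0"
    using g(2) by (simp add: G_def fps_expansion_def)
  have "(f \<circ> g) has_fps_expansion (F oo G)"
    by (rule has_fps_expansion_compose[OF F G G0])
  then have "egf_coeff (\<lambda>z. f (g z)) n = fact n * fps_nth (F oo G) n"
    by (simp add: egf_coeff_has_fps_expansion o_def)
  also have "\<dots> = (\<Sum>j=0..n. fact n * (fps_nth F j * fps_nth (G ^ j) n))"
    by (simp add: fps_compose_nth sum_distrib_left)
  also have "\<dots> = (\<Sum>j=0..n. egf_coeff f j * egf_coeff (\<lambda>z. g z ^ j / fact j) n)"
  proof (rule sum.cong[OF refl])
    fix j
    have "(\<lambda>z. g z ^ j * (1 / fact j)) has_fps_expansion G ^ j * fps_const (1 / fact j)"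
      by (intro fps_expansion_intros G)
    then have "egf_coeff (\<lambda>z. g z ^ j / fact j) n = fact n * (fps_nth (G ^ j) n / fact j)"
      using egf_coeff_has_fps_expansion by fastforce
    then show "fact n * (fps_nth F j * fps_nth (G ^ j) n) =
        egf_coeff f j * egf_coeff (\<lambda>z. g z ^ j / fact j) n"
      by (simp add: egf_coeff_has_fps_expansion[OF F])
  qed
  finally show ?thesis .
qed

lemma egf_coeff_scale:
  assumes "f analytic_on {0}"
  shows "egf_coeff (\<lambda>z. f (c * z)) n = c ^ n * egf_coeff f n"
proof -
  define F where "F = fps_expansion f 0"
  have F: "f has_fps_expansion F"
    unfolding F_def using assms by (rule analytic_at_imp_has_fps_expansion_0)
  have "(\<lambda>z. c * z) has_fps_expansion fps_const c * fps_X"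
    by (intro fps_expansion_intros)
  from has_fps_expansion_compose[OF F this]
  have "(\<lambda>z. f (c * z)) has_fps_expansion (F oo (fps_const c * fps_X))"
    by (simp add: o_def)
  then show ?thesis
    by (simp add: egf_coeff_has_fps_expansion[OF F] egf_coeff_has_fps_expansion
        fps_compose_linear)
qed

lemma egf_coeff_divide:
  assumes "f analytic_on {0}"
  shows "egf_coeff (\<lambda>z. f z / c) n = egf_coeff f n / c"
proof -
  define F where "F = fps_expansion f 0"
  have F: "f has_fps_expansion F"
    unfolding F_def using assms by (rule analytic_at_imp_has_fps_expansion_0)
  have "(\<lambda>z. f z * (1 / c)) has_fps_expansion F * fps_const (1 / c)"
    by (intro fps_expansion_intros F)
  then show ?thesis
    using egf_coeff_has_fps_expansion[OF F] egf_coeff_has_fps_expansion by fastforce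
qed

lemma egf_coeff_monomial:
  "egf_coeff (\<lambda>z. z ^ k / fact k) n = (if n = k then 1 else 0)"
proof -
  have "(\<lambda>z::complex. z ^ k * (1 / fact k)) has_fps_expansion fps_X ^ k * fps_const (1 / fact k)"
    by (intro fps_expansion_intros)
  then have "egf_coeff (\<lambda>z. z ^ k / fact k) n =
      fact n * fps_nth (fps_X ^ k * fps_const (1 / fact k)) n"
    using egf_coeff_has_fps_expansion by fastforce
  then show ?thesis by (auto simp: fps_X_power_nth)
qed

text \<open>This is Newton's binomial series on the unit disc, where n! times
  \<open>a gchoose n\<close> is the falling factorial.\<close>

lemma egf_coeff_binomial:
  "egf_coeff (\<lambda>z. (1 + z) powr a) n = (\<Prod>i<n. a - of_nat i)"
proof -
  have "\<forall>\<^sub>F z in nhds (0::complex). z \<in> ball 0 1"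
    by (intro eventually_nhds_in_open) auto
  then have "\<forall>\<^sub>F z in nhds 0.
      (\<lambda>n. (fact n * (a gchoose n)) * z ^ n / fact n) sums ((1 + z) powr a)"
    by eventually_elim (use gen_binomial_complex in simp)
  from egf_coeff_unique[OF this, of n] show ?thesis
    by (simp add: gbinomial_mult_fact lessThan_atLeast0)
qed

section \<open>Principal branches near 0\<close>

lemma analytic_at_imp_tendsto_nhds:
  assumes "g analytic_on {a}"
  shows "(g \<longlongrightarrow> g a) (nhds a)"
  using analytic_at_imp_isCont[OF assms] by (simp add: isCont_def tendsto_at_iff_tendsto_nhds)

text \<open>\<open>Ln\<close> inverts \<open>exp\<close> on the strip where the imaginary part lies
  strictly between -pi and pi; by continuity \<open>g\<close> stays in the disc of radius pi near
  0.\<close>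

lemma eventually_Ln_exp:
  fixes g :: "complex \<Rightarrow> complex"
  assumes "g analytic_on {0}" "g 0 = 0"
  shows "\<forall>\<^sub>F z in nhds 0. Ln (exp (g z)) = g z"
proof -
  have "\<forall>\<^sub>F z in nhds 0. g z \<in> ball 0 pi"
    using assms(2) by (intro topological_tendstoD[OF analytic_at_imp_tendsto_nhds[OF assms(1)]]) auto
  then show ?thesis
  proof eventually_elim
    case (elim z)
    then have "\<bar>Im (g z)\<bar> < pi"
      using abs_Im_le_cmod[of "g z"] by simp
    then show ?case by (intro Ln_exp) auto
  qed
qed

lemma eventually_Ln_powr:
  fixes a :: complex
  assumes "g analytic_on {0}" "g 0 = 0"
  shows "\<forall>\<^sub>F z in nhds 0. Ln ((1 + g z) powr a) = a * Ln (1 + g z)"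
proof -
  have "(\<lambda>z. a * Ln (1 + g z)) analytic_on {0}"
    using assms by (intro analytic_intros) auto
  then have "\<forall>\<^sub>F z in nhds 0. Ln (exp (a * Ln (1 + g z))) = a * Ln (1 + g z)"
    by (rule eventually_Ln_exp) (simp add: assms)
  \<comment> \<open>A zero base must be excluded: there \<open>powr\<close> is 0 by convention
    instead of an exponential.\<close>
  moreover have "\<forall>\<^sub>F z in nhds 0. 1 + g z \<noteq> 0"
    by (intro tendsto_imp_eventually_ne[where c = 1])
       (auto intro!: tendsto_eq_intros analytic_at_imp_tendsto_nhds[OF assms(1)] simp: assms(2))
  ultimately show ?thesis
    by eventually_elim (simp add: powr_def)
qed

section \<open>The logarithm of \<open>C_fun\<close> and its compositional inverse\<close>

lemma Ln_C_fun_analytic: "(\<lambda>z. Ln (C_fun l z)) analytic_on {0}"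
  by (intro analytic_Ln_F C_fun_analytic C_fun_0)

lemma eventually_Ln_C_fun:
  "\<forall>\<^sub>F z in nhds 0. Ln (C_fun l z) = 1 / of_real l * ((1 + z) powr of_real l - 1)"
  unfolding C_fun_def
  \<comment> \<open>For \<open>l = 0\<close> the convention 1 / 0 = 0 makes the exponent constantly
    0.\<close>
  by (rule eventually_Ln_exp) (cases "l = 0"; auto intro!: analytic_intros)+

lemma eventually_Ln_C_fun_B_fun:
  assumes "l \<noteq> 0"
  shows "\<forall>\<^sub>F z in nhds 0. Ln (C_fun l (B_fun l z - 1)) = z"
proof -
  have lim: "((\<lambda>z. B_fun l z - 1) \<longlongrightarrow> 0) (nhds 0)"
    by (auto intro!: tendsto_eq_intros analytic_at_imp_tendsto_nhds[OF B_fun_analytic] simp: B_fun_0)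
  have "\<forall>\<^sub>F z in nhds 0. Ln (C_fun l (B_fun l z - 1)) =
      1 / of_real l * ((1 + (B_fun l z - 1)) powr of_real l - 1)"
    using eventually_compose_filterlim[OF eventually_Ln_C_fun lim] .
  moreover have "\<forall>\<^sub>F z in nhds 0. Ln ((1 + of_real l * z) powr (1 / of_real l)) =
      1 / of_real l * Ln (1 + of_real l * z)"
    by (rule eventually_Ln_powr) (auto intro!: analytic_intros)
  moreover have "\<forall>\<^sub>F z in nhds (0::complex). 1 + of_real l * z \<noteq> 0"
    by (intro tendsto_imp_eventually_ne[where c = 1]) (auto intro!: tendsto_eq_intros filterlim_ident)
  ultimately show ?thesis
  proof eventually_elim
    case (elim z)
    have "B_fun l z powr of_real l = 1 + of_real l * z"
      \<comment> \<open>Only the outer power, with exponent \<open>of_real l\<close>, is unfolded,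
        so that the logarithm of the inner power can be rewritten and the exponents cancel.\<close>
      using elim assms by (simp add: B_fun_def powr_def[of _ "of_real l"])
    with elim show ?case using assms by simp
  qed
qed

text \<open>Near 0 the argument of the left-hand \<open>Ln\<close> is
  \<open>(1 + z) powr of_real l\<close>.\<close>

lemma eventually_Ln_1_plus_Ln_C_fun:
  assumes "l \<noteq> 0"
  shows "\<forall>\<^sub>F z in nhds 0. Ln (1 + of_real l * Ln (C_fun l z)) = of_real l * Ln (1 + z)"
proof -
  have "\<forall>\<^sub>F z in nhds 0. Ln ((1 + z) powr of_real l) = of_real l * Ln (1 + z)"
    by (rule eventually_Ln_powr) (auto intro!: analytic_intros)
  with eventually_Ln_C_fun[of l] show ?thesis
    by eventually_elim (use assms in simp)
qed

text \<open>With inner function \<open>Ln (C_fun l z)\<close>, the inner coefficients are by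
  definition the numbers \<open>stirling1_F (C_fun l) n j\<close>. The second and third identities
  both use this form.\<close>

lemma egf_coeff_compose_Ln_C_fun:
  assumes "f analytic_on {0}"
  shows "egf_coeff (\<lambda>z. f (Ln (C_fun l z))) n = (\<Sum>j=0..n. egf_coeff f j * stirling1_F (C_fun l) n j)"
  unfolding stirling1_F_def
  by (rule egf_coeff_compose) (auto simp: assms Ln_C_fun_analytic C_fun_0)

section \<open>The three identities\<close>

lemma sum_stirling2_B_stirling1_C:
  assumes "l \<noteq> 0" "k \<le> n"
  shows "(\<Sum>j=k..n. stirling2_F (B_fun l) n j * stirling1_F (C_fun l) j k) =
    (if n = k then 1 else 0)"
proof -
  have f: "(\<lambda>w. Ln (C_fun l w) ^ k / fact k) analytic_on {0}"
    by (intro analytic_intros Ln_C_fun_analytic) auto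
  \<comment> \<open>The sum can start at 0 because \<open>stirling1_F (C_fun l) j k\<close> vanishes
    for j < k.\<close>
  have "(\<Sum>j=k..n. stirling2_F (B_fun l) n j * stirling1_F (C_fun l) j k) =
      (\<Sum>j=0..n. stirling2_F (B_fun l) n j * stirling1_F (C_fun l) j k)"
    by (rule sum.mono_neutral_left) (auto simp: stirling1_F_sums(2)[OF C_fun_analytic C_fun_0])
  also have "\<dots> = (\<Sum>j=0..n. egf_coeff (\<lambda>w. Ln (C_fun l w) ^ k / fact k) j *
      egf_coeff (\<lambda>z. (B_fun l z - 1) ^ j / fact j) n)"
    by (simp add: stirling1_F_def stirling2_F_def mult.commute)
  also have "\<dots> = egf_coeff (\<lambda>z. Ln (C_fun l (B_fun l z - 1)) ^ k / fact k) n"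
    by (rule egf_coeff_compose[OF f, symmetric])
       (auto intro!: analytic_intros B_fun_analytic simp: B_fun_0)
  also have "\<dots> = egf_coeff (\<lambda>z. z ^ k / fact k) n"
  proof (rule egf_coeff_cong[symmetric])
    show "\<forall>\<^sub>F z in nhds 0. z ^ k / fact k = Ln (C_fun l (B_fun l z - 1)) ^ k / fact k"
      using eventually_Ln_C_fun_B_fun[OF assms(1)] by eventually_elim simp
  qed (auto intro!: analytic_intros)
  finally show ?thesis by (simp add: egf_coeff_monomial)
qed

lemma signed_stirling1_eq_sum_stirling1_C:
  assumes "l \<noteq> 0" "k \<le> n"
  shows "signed_stirling1 n k =
    (\<Sum>j=k..n. stirling1_F (C_fun l) n j * of_real l ^ (j - k) * signed_stirling1 j k)"
proof -
  define f :: "complex \<Rightarrow> complex" where "f = (\<lambda>w. Ln (1 + w) ^ k / fact k)"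
  have f: "f analytic_on {0}"
    unfolding f_def by (intro analytic_intros) auto
  have fl: "(\<lambda>w. f (of_real l * w)) analytic_on {0}"
    unfolding f_def by (intro analytic_intros) auto
  then have fl': "(\<lambda>w. f (of_real l * w) / of_real l ^ k) analytic_on {0}"
    using assms by (intro analytic_intros) auto
  \<comment> \<open>Scaling the argument by l yields the factor \<open>l ^ j\<close>. Division by
    \<open>l ^ k\<close> offsets the factor l in \<open>Ln (1 + l * Ln C) = l * Ln (1 + z)\<close>,
    raised to the power k.\<close>
  have coeff: "egf_coeff (\<lambda>w. f (of_real l * w) / of_real l ^ k) j =
      of_real l ^ j / of_real l ^ k * signed_stirling1 j k" for j
    using egf_coeff_divide[OF fl] egf_coeff_scale[OF f]
    by (simp add: signed_stirling1_def f_def)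
  have zero: "signed_stirling1 j k = 0" if "j < k" for j
    unfolding signed_stirling1_def using that
    by (intro egf_coeff_power_eq_0) (auto intro!: analytic_intros)
  have "signed_stirling1 n k =
      egf_coeff (\<lambda>z. f (of_real l * Ln (C_fun l z)) / of_real l ^ k) n"
    unfolding signed_stirling1_def
  proof (rule egf_coeff_cong)
    show "\<forall>\<^sub>F z in nhds 0. Ln (1 + z) ^ k / fact k = f (of_real l * Ln (C_fun l z)) / of_real l ^ k"
      using eventually_Ln_1_plus_Ln_C_fun[OF assms(1)]
      by eventually_elim (use assms in \<open>simp add: f_def power_mult_distrib\<close>)
  qed (use f in \<open>simp add: f_def\<close>)
  also have "\<dots> = (\<Sum>j=0..n. of_real l ^ j / of_real l ^ k * signed_stirling1 j k *
      stirling1_F (C_fun l) n j)"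
    using egf_coeff_compose_Ln_C_fun[OF fl'] by (simp add: coeff)
  also have "\<dots> = (\<Sum>j=k..n. of_real l ^ j / of_real l ^ k * signed_stirling1 j k *
      stirling1_F (C_fun l) n j)"
    by (rule sum.mono_neutral_right) (auto simp: zero)
  \<comment> \<open>Once the terms with j < k are gone, the quotient of powers agrees with the
    truncated exponent \<open>j - k\<close>.\<close>
  also have "\<dots> = (\<Sum>j=k..n. stirling1_F (C_fun l) n j * of_real l ^ (j - k) * signed_stirling1 j k)"
    using assms by (intro sum.cong) (auto simp: power_diff)
  finally show ?thesis .
qed

lemma ffact_eq_sum_stirling1_C:
  assumes "l \<noteq> 0"
  shows "complex_of_real (ffact x n) =
    (\<Sum>k=0..n. stirling1_F (C_fun l) n k * of_real (ffact_step x k l))"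
proof -
  define a :: complex where "a = of_real (x / l)"
  have p: "(\<lambda>w. (1 + w) powr a) analytic_on {0}"
    by (intro analytic_intros) auto
  have pl: "(\<lambda>w. (1 + of_real l * w) powr a) analytic_on {0}"
    by (intro analytic_intros) auto
  have coeff: "egf_coeff (\<lambda>w. (1 + of_real l * w) powr a) k = of_real (ffact_step x k l)" for k
  proof -
    have "egf_coeff (\<lambda>w. (1 + of_real l * w) powr a) k =
        of_real l ^ k * (\<Prod>i<k. a - of_nat i)"
      by (simp add: egf_coeff_scale[OF p] egf_coeff_binomial)
    also have "\<dots> = (\<Prod>i<k. of_real l * (a - of_nat i))"
      by (simp add: prod.distrib)
    \<comment> \<open>Each factor l turns \<open>x / l - i\<close> into \<open>x - i * l\<close>;
      this is the reason for the exponent \<open>a = x / l\<close>.\<close>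
    also have "\<dots> = (\<Prod>i<k. of_real (x - of_nat i * l))"
      using assms by (intro prod.cong) (auto simp: a_def field_simps)
    finally show ?thesis by (simp add: ffact_step_def)
  qed
  have "complex_of_real (ffact x n) = egf_coeff (\<lambda>z. (1 + z) powr of_real x) n"
    by (simp add: egf_coeff_binomial ffact_def)
  also have "\<dots> = egf_coeff (\<lambda>z. (1 + of_real l * Ln (C_fun l z)) powr a) n"
  proof (rule egf_coeff_cong)
    have "\<forall>\<^sub>F z in nhds (0::complex). 1 + z \<noteq> 0"
      by (intro tendsto_imp_eventually_ne[where c = 1]) (auto intro!: tendsto_eq_intros filterlim_ident)
    with eventually_Ln_1_plus_Ln_C_fun[OF assms] eventually_Ln_C_fun[of l]
    show "\<forall>\<^sub>F z in nhds 0. (1 + z) powr of_real x = (1 + of_real l * Ln (C_fun l z)) powr a"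
    proof eventually_elim
      case (elim z)
      \<comment> \<open>This base equals \<open>(1 + z) powr of_real l\<close>, so both powers
        unfold to exponentials, with common exponent \<open>x * Ln (1 + z)\<close>.\<close>
      then have "1 + of_real l * Ln (C_fun l z) \<noteq> 0"
        using assms by simp
      with elim assms show ?case
        by (simp add: powr_def a_def)
    qed
  qed (auto intro!: analytic_intros)
  also have "\<dots> = (\<Sum>k=0..n. stirling1_F (C_fun l) n k * of_real (ffact_step x k l))"
    using egf_coeff_compose_Ln_C_fun[OF pl] unfolding coeff by (simp add: mult.commute)
  finally show ?thesis .
qed

theorem theorem13:
  fixes l :: real
  assumes "l \<noteq> 0"
  shows "(\<forall>n k. k \<le> n \<longrightarrow>
            (if n = k then 1 else 0) =
              (\<Sum>j=k..n. stirling2_F (B_fun l) n j * stirling1_F (C_fun l) j k) \<and>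
            signed_stirling1 n k =
              (\<Sum>j=k..n. stirling1_F (C_fun l) n j * of_real l ^ (j - k) * signed_stirling1 j k)) \<and>
         (\<forall>n (x::real).
            complex_of_real (ffact x n) =
              (\<Sum>k=0..n. stirling1_F (C_fun l) n k * of_real (ffact_step x k l)))"
  using sum_stirling2_B_stirling1_C[OF assms] signed_stirling1_eq_sum_stirling1_C[OF assms]
    ffact_eq_sum_stirling1_C[OF assms]
  by metis

end
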